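(* $\pi(P\square P)\le 12$, where $P$ is the two-way infinite path.
   Context: $P$ is the graph with vertex set $\mathbb{Z}$ where $i$ and $i+1$ are adjacent. For graphs $G,H$, the Cartesian product $G\square H$ has vertex set $V(G)\times V(H)$, with $(g,h)\sim(g',h')$ iff ($g=g'$ and $hh'\in E(H)$) or ($h=h'$ and $gg'\in E(G)$); thus $P\square P$ is the infinite square grid on $\mathbb{Z}^2$. A vertex coloring $c$ of a graph is non-repetitive if there is no path $v_1,\dots,v_{2k}$ ($k\ge1$, distinct vertices, consecutive ones adjacent) with $c(v_i)=c(v_{k+i})$ for all $1\le i\le k$. The non-repetitive chromatic number $\pi(G)$ is the minimum number of colors in a non-repetitive coloring of $G$. *)

theory Defs
  imports "Graph_Theory.Graph_Theory" "HOL-Library.Extended_Nat"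
begin

text \<open>
  A (possibly infinite) simple undirected graph is represented as a symmetric, loop-free
  digraph without parallel arcs, i.e. as an instance of \<^locale>\<open>pair_bidirected_digraph\<close>.
\<close>

definition infinite_path :: "int pair_pre_digraph" where
  "infinite_path =
     \<lparr> pverts = UNIV, parcs = {(i, j). j = i + 1 \<or> i = j + 1} \<rparr>"

definition cartesian_product ::
    "'a pair_pre_digraph \<Rightarrow> 'b pair_pre_digraph \<Rightarrow> ('a \<times> 'b) pair_pre_digraph"
    (infixr \<open>\<box>\<close> 70) where
  "G \<box> H =
     \<lparr> pverts = pverts G \<times> pverts H,
       parcs = {((g, h), (g', h')).
                  g \<in> pverts G \<and> g = g' \<and> (h, h') \<in> parcs H \<or>
                  h \<in> pverts H \<and> h = h' \<and> (g, g') \<in> parcs G} \<rparr>"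

definition nonrepetitive_coloring :: "'a pair_pre_digraph \<Rightarrow> ('a \<Rightarrow> 'c) \<Rightarrow> bool" where
  "nonrepetitive_coloring G c \<longleftrightarrow>
     \<not> (\<exists>k v. k \<ge> 1 \<and> vpath v (with_proj G) \<and> length v = 2 * k \<and>
          (\<forall>i<k. c (v ! i) = c (v ! (k + i))))"

text \<open>
  The value is \<open>\<infinity>\<close> iff no colouring with finitely many colours is non-repetitive. Otherwise
  the infimum is attained, since \<^typ>\<open>enat\<close> is well-ordered.
\<close>

definition nonrepetitive_chromatic_number :: "'a pair_pre_digraph \<Rightarrow> enat" (\<open>\<pi>\<close>) where
  "\<pi> G = (INF k \<in> {k. \<exists>c :: 'a \<Rightarrow> nat. c ` pverts G \<subseteq> {..<k} \<and> nonrepetitive_coloring G c}. enat k)"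

lemma pair_bidirected_digraph_infinite_path: "pair_bidirected_digraph infinite_path"
  by unfold_locales (auto simp: infinite_path_def symmetric_def sym_def)

lemma pair_bidirected_digraph_cartesian_product:
  assumes "pair_bidirected_digraph G" "pair_bidirected_digraph H"
  shows "pair_bidirected_digraph (G \<box> H)"
proof -
  interpret G: pair_bidirected_digraph G by fact
  interpret H: pair_bidirected_digraph H by fact
  have "sym (parcs G)" "sym (parcs H)"
    using G.pair_sym_arcs H.pair_sym_arcs by (simp_all add: symmetric_def)
  then show ?thesis
    by unfold_locales
      (auto simp: cartesian_product_def symmetric_def sym_def
        dest: G.in_arcsD1 G.in_arcsD2 H.in_arcsD1 H.in_arcsD2 G.pair_no_loops H.pair_no_loops)
qed

lemma nonrepetitive_chromatic_number_le_iff: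
  fixes G :: "'a pair_pre_digraph"
  shows "\<pi> G \<le> enat n \<longleftrightarrow>
    (\<exists>c :: 'a \<Rightarrow> nat. c ` pverts G \<subseteq> {..<n} \<and> nonrepetitive_coloring G c)"
proof
  let ?K = "{k. \<exists>c :: 'a \<Rightarrow> nat. c ` pverts G \<subseteq> {..<k} \<and> nonrepetitive_coloring G c}"
  assume le: "\<pi> G \<le> enat n"
  then obtain k where "k \<in> ?K"
    by (auto simp: nonrepetitive_chromatic_number_def Inf_enat_def split: if_splits)
  then have "\<pi> G \<in> enat ` ?K"
    unfolding nonrepetitive_chromatic_number_def by (intro wellorder_InfI[of "enat k"]) (rule imageI)
  then obtain m c where m: "\<pi> G = enat m"
      and c: "c ` pverts G \<subseteq> {..<m}" "nonrepetitive_coloring G c"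
    by (elim imageE CollectE exE conjE)
  from le m have "{..<m} \<subseteq> {..<n}"
    by simp
  with c(1) have "c ` pverts G \<subseteq> {..<n}"
    by (rule subset_trans)
  with c(2) show "\<exists>c :: 'a \<Rightarrow> nat. c ` pverts G \<subseteq> {..<n} \<and> nonrepetitive_coloring G c"
    by (intro exI[of _ c] conjI)
next
  assume "\<exists>c :: 'a \<Rightarrow> nat. c ` pverts G \<subseteq> {..<n} \<and> nonrepetitive_coloring G c"
  then show "\<pi> G \<le> enat n"
    unfolding nonrepetitive_chromatic_number_def by (rule INF_lower[OF CollectI])
qed

end

theory Submission
  imports Defs
begin

text \<open>
  Colour \<open>(x, y)\<close> by the pair \<open>(c x, d (x + y))\<close>, where \<open>c\<close> is a square-free ternary word over the
  integers and \<open>d\<close> a word in four letters for which every walk \<open>u\<^sub>1, \<dots>, u\<^sub>2\<^sub>k\<close> with steps \<open>\<plusminus>1\<close>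
  and repetitive colours satisfies \<open>u\<^sub>i = u\<^sub>k\<^sub>+\<^sub>i\<close>. Every step in the grid changes \<open>x + y\<close> by
  \<open>\<plusminus>1\<close>, so along a repetitive path corresponding vertices of the two halves lie on the same
  antidiagonal. As \<open>c\<close> is proper, the two halves then make the same steps, i.e. the second half is
  a translate of the first one; projecting to the \<open>x\<close>-axis yields a square in \<open>c\<close> unless the
  translation is trivial.
\<close>

section \<open>Square-free words over the integers\<close>

definition squarefree_word :: "(int \<Rightarrow> 'a) \<Rightarrow> bool" where
  "squarefree_word f \<longleftrightarrow> (\<forall>n. \<forall>p\<ge>1. \<exists>j. n \<le> j \<and> j < n + p \<and> f j \<noteq> f (j + p))"

lemma squarefree_wordD:
  assumes "squarefree_word f" "p \<ge> 1"
  obtains j where "n \<le> j" "j < n + p" "f j \<noteq> f (j + p)"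
  using assms unfolding squarefree_word_def by blast

lemma squarefree_word_neq_Suc:
  assumes "squarefree_word f"
  shows "f n \<noteq> f (n + 1)"
proof -
  obtain j where j: "n \<le> j" "j < n + 1" "f j \<noteq> f (j + 1)"
    using squarefree_wordD[OF assms, of 1 n] by auto
  from j(1,2) have "j = n" by simp
  with j(3) show ?thesis by simp
qed

section \<open>A two-sided Thue--Morse word and its overlap-freeness\<close>

fun thue_morse :: "nat \<Rightarrow> bool" where
  "thue_morse n = (if n = 0 then False else thue_morse (n div 2) \<noteq> odd n)"

declare thue_morse.simps [simp del]

lemma thue_morse_double: "thue_morse (2 * n) = thue_morse n"
  by (cases "n = 0") (simp_all add: thue_morse.simps[of "2 * n"])

lemma thue_morse_double_Suc: "thue_morse (Suc (2 * n)) = (\<not> thue_morse n)"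
  by (simp add: thue_morse.simps[of "Suc (2 * n)"])

text \<open>
  The reflection of the Thue--Morse word, complemented iff \<open>e\<close> holds, is put to the left of
  the word itself. Both values of \<open>e\<close> are needed, since passing to the even positions swaps
  them.
\<close>

definition thue_morse_int :: "bool \<Rightarrow> int \<Rightarrow> bool" where
  "thue_morse_int e n =
     (if n \<ge> 0 then thue_morse (nat n) else e \<noteq> thue_morse (nat (- 1 - n)))"

text \<open>For negative \<open>n\<close> the mirror image \<open>- 1 - 2 * n\<close> is odd, so the
  halving rule of \<open>thue_morse\<close> negates, and flipping \<open>e\<close> absorbs the
  negation.\<close>

lemma thue_morse_int_double: "thue_morse_int e (2 * n) = thue_morse_int (\<not> e) n"
proof (cases "n \<ge> 0")
  case True
  then have "nat (2 * n) = 2 * nat n" by simp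
  with True show ?thesis by (simp add: thue_morse_int_def thue_morse_double)
next
  case False
  then have "nat (- 1 - 2 * n) = Suc (2 * nat (- 1 - n))" by simp
  with False show ?thesis
    by (simp add: thue_morse_int_def thue_morse_double_Suc del: nat_minus_as_int)
qed

lemma thue_morse_int_double_Suc:
  "thue_morse_int e (2 * n + 1) = (\<not> thue_morse_int (\<not> e) n)"
proof (cases "n \<ge> 0")
  case True
  then have "nat (2 * n + 1) = Suc (2 * nat n)" by simp
  with True show ?thesis by (simp add: thue_morse_int_def thue_morse_double_Suc)
next
  case False
  then have "nat (- 1 - (2 * n + 1)) = 2 * nat (- 1 - n)" by simp
  moreover have "\<not> 2 * n + 1 \<ge> 0" using False by simp
  ultimately show ?thesis using False
    unfolding thue_morse_int_def by (simp only: thue_morse_double if_False) simp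
qed

lemma thue_morse_int_even_neq_Suc:
  assumes "even j"
  shows "thue_morse_int e j \<noteq> thue_morse_int e (j + 1)"
  using assms by (auto elim!: evenE simp: thue_morse_int_double thue_morse_int_double_Suc)

text \<open>Descent on the period: an overlap of even period restricts, on the positions with the
  parity of \<open>n\<close>, to one of half the period.\<close>

lemma thue_morse_int_overlap_free:
  assumes "p \<ge> 1"
  shows "\<exists>i. 0 \<le> i \<and> i \<le> int p \<and> thue_morse_int e (n + i) \<noteq> thue_morse_int e (n + i + int p)"
  using assms
proof (induction p arbitrary: e n rule: less_induct)
  case (less p)
  show ?case
  proof (rule ccontr)
    assume "\<not> ?thesis"
    then have eq: "thue_morse_int e (n + i) = thue_morse_int e (n + i + int p)"
      if "0 \<le> i" "i \<le> int p" for i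
      using that by blast
    show False
    proof (cases "even p")
      case True
      then obtain q where q: "p = 2 * q" by (elim evenE)
      with less.prems have "q < p" "q \<ge> 1" by auto
      from less.IH[OF this, of "\<not> e" "n div 2"] obtain i where i: "0 \<le> i" "i \<le> int q"
        and neq: "thue_morse_int (\<not> e) (n div 2 + i)
          \<noteq> thue_morse_int (\<not> e) (n div 2 + i + int q)"
        by blast
      have "thue_morse_int e (n + 2 * i) = thue_morse_int e (n + 2 * i + int p)"
        using i q by (intro eq) auto
      moreover have "n + 2 * i = 2 * (n div 2 + i) \<and>
            n + 2 * i + int p = 2 * (n div 2 + i + int q) \<or>
          n + 2 * i = 2 * (n div 2 + i) + 1 \<and>
            n + 2 * i + int p = 2 * (n div 2 + i + int q) + 1"
        unfolding q by presburger
      ultimately show False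
        using neq thue_morse_int_double[of e] thue_morse_int_double_Suc[of e] by metis
    next
      case False
      \<comment> \<open>An overlap of odd period forces its second half to alternate.\<close>
      have step: "thue_morse_int e (n + int p + int i) \<noteq> thue_morse_int e (n + int p + int i + 1)"
        if "i < p" for i
      proof (cases "even (n + int p + int i)")
        case True
        then show ?thesis by (rule thue_morse_int_even_neq_Suc)
      next
        case odd: False
        with False have "even (n + int i)" by auto
        then have "thue_morse_int e (n + int i) \<noteq> thue_morse_int e (n + int i + 1)"
          by (rule thue_morse_int_even_neq_Suc)
        with eq[of "int i"] eq[of "int i + 1"] that show ?thesis by (simp add: ac_simps)
      qed
      have "i \<le> p \<Longrightarrow>
          thue_morse_int e (n + int p + int i) = (thue_morse_int e (n + int p) = even i)" for i
      proof (induction i)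
        case (Suc i)
        with step[of i] show ?case by (auto simp: ac_simps)
      qed simp
      \<comment> \<open>Alternating for \<open>p\<close> steps, an odd number, flips the letter, yet
        the extra last letter of the overlap repeats it.\<close>
      from this[of p] False eq[of "int p"] show False by simp
    qed
  qed
qed

section \<open>A square-free ternary word\<close>

text \<open>
  The letters 0, 1, 2 encode the differences 0, -1, 1 of consecutive Thue--Morse letters. A square
  of differences telescopes to an overlap.
\<close>

definition ternary_word :: "int \<Rightarrow> nat" where
  "ternary_word n =
     (if thue_morse_int False n = thue_morse_int False (n + 1) then 0
      else if thue_morse_int False n then 1 else 2)"

lemma ternary_word_less: "ternary_word n < 3"
  by (simp add: ternary_word_def)

lemma squarefree_ternary_word: "squarefree_word ternary_word"
  unfolding squarefree_word_def
proof (intro allI impI, rule ccontr)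
  fix n p :: int
  let ?t = "thue_morse_int False"
  let ?D = "\<lambda>j. of_bool (?t (j + p)) - of_bool (?t j) :: int"
  assume p: "p \<ge> 1" and "\<not> (\<exists>j. n \<le> j \<and> j < n + p \<and> ternary_word j \<noteq> ternary_word (j + p))"
  then have eq: "ternary_word j = ternary_word (j + p)" if "n \<le> j" "j < n + p" for j
    using that by blast
  have D: "?D (n + int i) = ?D n" if "int i \<le> p" for i
    using that
  proof (induction i)
    case (Suc i)
    have "?D (n + int i + 1) = ?D (n + int i)"
      using eq[of "n + int i"] Suc.prems
      by (auto simp: ternary_word_def ac_simps of_bool_def split: if_splits)
    with Suc show ?case by (simp add: ac_simps)
  qed simp
  have "?D (n + p) = ?D n" using D[of "nat p"] p by simp
  \<comment> \<open>The letters at \<open>n\<close>, \<open>n + p\<close>, \<open>n + 2 * p\<close>,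
    read as 0 or 1, form an arithmetic progression, which must be constant.\<close>
  then have "?D n = 0" by (auto simp: of_bool_def split: if_splits)
  then have "?t (n + int i) = ?t (n + int i + p)" if "int i \<le> p" for i
    using D[OF that] by (auto simp: of_bool_def split: if_splits)
  moreover obtain i where "0 \<le> i" "i \<le> p" "?t (n + i) \<noteq> ?t (n + i + p)"
    using thue_morse_int_overlap_free[of "nat p" False n] p by (auto simp: Suc_le_eq)
  ultimately show False by (metis zero_le_imp_eq_int)
qed

section \<open>A square-free word on four letters without palindromes of length 3\<close>

text \<open>
  Inserting a fourth letter into \<open>ternary_word\<close> after every second letter destroys all palindromes
  of length 3.
\<close>

definition quaternary_word :: "int \<Rightarrow> nat" where
  "quaternary_word n =
     (if n mod 3 = 0 then 3 else ternary_word (2 * (n div 3) + n mod 3 - 1))"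

lemma quaternary_word_less: "quaternary_word n < 4"
  using ternary_word_less by (simp add: quaternary_word_def less_SucI eval_nat_numeral)

lemma quaternary_word_eq_3_iff: "quaternary_word n = 3 \<longleftrightarrow> n mod 3 = 0"
  using ternary_word_less by (simp add: quaternary_word_def less_imp_neq)

lemma quaternary_word_position:
  "quaternary_word (3 * (s div 2) + s mod 2 + 1) = ternary_word s"
proof -
  have "(3 * (s div 2) + s mod 2 + 1) mod 3 = s mod 2 + 1"
    "(3 * (s div 2) + s mod 2 + 1) div 3 = s div 2"
    by presburger+
  moreover have "s mod 2 + 1 \<noteq> 0" by presburger
  ultimately show ?thesis by (simp add: quaternary_word_def)
qed

lemma quaternary_word_neq_Suc: "quaternary_word n \<noteq> quaternary_word (n + 1)"
proof (cases "n mod 3 = 1")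
  case True
  then have "n = 3 * (2 * (n div 3) div 2) + 2 * (n div 3) mod 2 + 1"
    "n + 1 = 3 * ((2 * (n div 3) + 1) div 2) + (2 * (n div 3) + 1) mod 2 + 1"
    by presburger+
  then show ?thesis
    using quaternary_word_position squarefree_word_neq_Suc[OF squarefree_ternary_word] by metis
next
  case False
  then have "(n mod 3 = 0) \<noteq> ((n + 1) mod 3 = 0)" by presburger
  then show ?thesis by (metis quaternary_word_eq_3_iff)
qed

text \<open>Either exactly one of the two positions carries the marker 3, or they surround a marker
  and hold consecutive letters of \<open>ternary_word\<close>.\<close>

lemma quaternary_word_neq_Suc_Suc: "quaternary_word n \<noteq> quaternary_word (n + 2)"
proof (cases "n mod 3 = 2")
  case True
  then have "n = 3 * ((2 * (n div 3) + 1) div 2) + (2 * (n div 3) + 1) mod 2 + 1"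
    "n + 2 = 3 * ((2 * (n div 3) + 1 + 1) div 2) + (2 * (n div 3) + 1 + 1) mod 2 + 1"
    by presburger+
  then show ?thesis
    using quaternary_word_position squarefree_word_neq_Suc[OF squarefree_ternary_word] by metis
next
  case False
  then have "(n mod 3 = 0) \<noteq> ((n + 2) mod 3 = 0)" by presburger
  then show ?thesis by (metis quaternary_word_eq_3_iff)
qed

text \<open>Markers force the period of a square to be some \<open>3 * q\<close>; deleting them
  leaves a square of period \<open>2 * q\<close> in \<open>ternary_word\<close>.\<close>

lemma squarefree_quaternary_word: "squarefree_word quaternary_word"
  unfolding squarefree_word_def
proof (intro allI impI, rule ccontr)
  fix n p :: int
  assume p: "p \<ge> 1"
    and "\<not> (\<exists>j. n \<le> j \<and> j < n + p \<and> quaternary_word j \<noteq> quaternary_word (j + p))"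
  then have eq: "quaternary_word j = quaternary_word (j + p)" if "n \<le> j" "j < n + p" for j
    using that by blast
  have "p \<noteq> 1" "p \<noteq> 2"
    using eq[of n] quaternary_word_neq_Suc[of n] quaternary_word_neq_Suc_Suc[of n] by auto
  with p have "p \<ge> 3" by simp
  then have "n \<le> n + (- n) mod 3" "n + (- n) mod 3 < n + p" "(n + (- n) mod 3) mod 3 = 0"
    by presburger+
  then obtain j where j: "n \<le> j" "j < n + p" "j mod 3 = 0"
    by (rule that)
  with eq[of j] have "(j + p) mod 3 = 0" by (metis quaternary_word_eq_3_iff)
  with j(3) have "p = 3 * (p div 3)" by presburger
  then obtain q where q: "p = 3 * q" ..
  \<comment> \<open>The index of the first letter of \<open>ternary_word\<close> placed at or after
    \<open>n\<close>.\<close>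
  define s where "s = 2 * (n div 3) + (if n mod 3 = 2 then 1 else 0)"
  obtain i where i: "s \<le> i" "i < s + 2 * q" "ternary_word i \<noteq> ternary_word (i + 2 * q)"
    using squarefree_wordD[OF squarefree_ternary_word, of "2 * q" s] p q by auto
  define j where "j = 3 * (i div 2) + i mod 2 + 1"
  have "n \<le> j" using i(1) unfolding j_def s_def by (auto split: if_splits; presburger)
  moreover have "j < n + p" using i(2) unfolding j_def s_def q by (auto split: if_splits; presburger)
  ultimately have "quaternary_word j = quaternary_word (j + p)" by (rule eq)
  moreover have "j + p = 3 * ((i + 2 * q) div 2) + (i + 2 * q) mod 2 + 1"
    unfolding j_def q by presburger
  ultimately show False
    using i(3) quaternary_word_position unfolding j_def by metis
qed

section \<open>Walks on the integers with repetitive colours\<close>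

text \<open>The walk visits every integer between \<open>w 0\<close> and \<open>w 0 + d\<close>, so
  a nonzero \<open>d\<close> would yield a square of period \<open>\<bar>d\<bar>\<close> in
  \<open>f\<close>.\<close>

lemma squarefree_word_walk:
  fixes w :: "nat \<Rightarrow> int"
  assumes f: "squarefree_word f"
    and step: "\<And>i. i < k \<Longrightarrow> \<bar>w (Suc i) - w i\<bar> \<le> 1"
    and eq: "\<And>i. i < k \<Longrightarrow> f (w i) = f (w i + d)"
    and last: "w k = w 0 + d"
  shows "d = 0"
proof (rule ccontr)
  assume "d \<noteq> 0"
  then consider "d \<ge> 1" | "- d \<ge> 1" by linarith
  then show False
  proof cases
    case 1
    obtain j where j: "w 0 \<le> j" "j < w 0 + d" "f j \<noteq> f (j + d)"
      using squarefree_wordD[OF f 1] .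
    obtain i where "i \<le> k" "w i = j"
      using nat_intermed_int_val[of 0 k w j] step j last by auto
    with j eq last show False by (metis le_neq_implies_less less_irrefl)
  next
    case 2
    \<comment> \<open>The window makes \<open>j - d\<close> range over the integers above
      \<open>w k\<close> up to \<open>w 0\<close>, all visited before time \<open>k\<close>, as
      \<open>eq\<close> needs.\<close>
    obtain j where j: "w 0 + 2 * d + 1 \<le> j" "j < w 0 + 2 * d + 1 - d" "f j \<noteq> f (j - d)"
      using squarefree_wordD[OF f 2, of "w 0 + 2 * d + 1"] by auto
    have "\<exists>i. 0 \<le> i \<and> i \<le> k \<and> - w i = - (j - d)"
      using step j last by (intro nat_intermed_int_val) (auto simp: abs_minus_commute)
    then obtain i where i: "i \<le> k" "w i = j - d" by auto
    with last j have "i \<noteq> k" by auto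
    with i eq[of i] j show False by simp
  qed
qed

text \<open>The halves step either always in parallel, giving a translation to which
  \<open>squarefree_word_walk\<close> applies, or always oppositely, giving a reflection.\<close>

lemma repetitive_walk_boring:
  fixes w :: "nat \<Rightarrow> int"
  assumes f: "squarefree_word f" and f2: "\<And>j. f j \<noteq> f (j + 2)"
    and step: "\<And>i. Suc i < 2 * k \<Longrightarrow> \<bar>w (Suc i) - w i\<bar> = 1"
    and eq: "\<And>i. i < k \<Longrightarrow> f (w i) = f (w (k + i))"
    and "i < k"
  shows "w (k + i) = w i"
proof -
  have k: "0 < k" using \<open>i < k\<close> by simp
  have f1: "f j \<noteq> f (j + 1)" for j
    by (rule squarefree_word_neq_Suc[OF f])
  have f2': "f j \<noteq> f (j + 2)" "f j \<noteq> f (j - 2)" for j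
    using f2[of j] f2[of "j - 2"] by simp_all
  define s where "s i = w (Suc i) - w i" for i
  have w_Suc: "w (Suc i) = w i + s i" for i
    by (simp add: s_def)
  have s: "s i = 1 \<or> s i = - 1" if "Suc i < 2 * k" for i
    using step[OF that] by (auto simp: s_def)
  \<comment> \<open>Otherwise, within two steps, one half returns to its start and the other moves
    by 2, against \<open>f2\<close>.\<close>
  have s_cong: "s (Suc i) = s (k + Suc i) \<longleftrightarrow> s i = s (k + i)" if "Suc (Suc i) < k" for i
  proof -
    have fe: "f (w i) = f (w (k + i))"
      "f (w i + s i + s (Suc i)) = f (w (k + i) + s (k + i) + s (k + Suc i))"
      using eq[of i] eq[of "Suc (Suc i)"] that by (simp_all add: w_Suc)
    have ss: "s i = 1 \<or> s i = - 1" "s (k + i) = 1 \<or> s (k + i) = - 1"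
      "s (Suc i) = 1 \<or> s (Suc i) = - 1" "s (k + Suc i) = 1 \<or> s (k + Suc i) = - 1"
      using that by (auto intro!: s)
    have "f (w i) = f (w i - 2) \<or> f (w i) = f (w i + 2) \<or>
        f (w (k + i)) = f (w (k + i) - 2) \<or> f (w (k + i)) = f (w (k + i) + 2)"
      if "(s (Suc i) = s (k + Suc i)) \<noteq> (s i = s (k + i))"
    proof -
      define a b where "a = s i + s (Suc i)" and "b = s (k + i) + s (k + Suc i)"
      have ab: "a = 0 \<and> (b = 2 \<or> b = - 2) \<or> b = 0 \<and> (a = 2 \<or> a = - 2)"
        using that ss by (auto simp: a_def b_def)
      have "f (w i + a) = f (w (k + i) + b)"
        using fe(2) by (simp add: a_def b_def add.assoc)
      with ab fe(1) show ?thesis by auto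
    qed
    then show ?thesis
      using f2' by metis
  qed
  have s_rel: "Suc i < k \<Longrightarrow> s i = s (k + i) \<longleftrightarrow> s 0 = s k" for i
  proof (induction i)
    case (Suc i)
    with s_cong[of i] show ?case by simp
  qed simp
  show ?thesis
  proof (cases "s 0 = s k")
    case True
    have shift: "i < k \<Longrightarrow> w (k + i) = w i + (w k - w 0)" for i
    proof (induction i)
      case (Suc i)
      with s_rel[of i] True show ?case by (simp add: w_Suc)
    qed simp
    have "w k - w 0 = 0"
    proof (rule squarefree_word_walk[OF f, of k w])
      show "\<bar>w (Suc i) - w i\<bar> \<le> 1" if "i < k" for i
        using step[of i] that by simp
      show "f (w i) = f (w i + (w k - w 0))" if "i < k" for i
        using eq[OF that] shift[OF that] by simp
    qed simp
    with shift[OF \<open>i < k\<close>] show ?thesis by simp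
  next
    case False
    have reflect: "i < k \<Longrightarrow> w (k + i) = w 0 + w k - w i" for i
    proof (induction i)
      case (Suc i)
      then have "s i \<noteq> s (k + i)" "s i = 1 \<or> s i = - 1" "s (k + i) = 1 \<or> s (k + i) = - 1"
        using s_rel[of i] False by (auto intro!: s)
      with Suc show ?case by (auto simp: w_Suc)
    qed simp
    \<comment> \<open>The walk passes the centre of reflection, where \<open>f\<close> would have a palindrome of length 2 or 3.\<close>
    define m where "m = (w 0 + w k) div 2"
    have step': "\<bar>w (Suc i) - w i\<bar> \<le> 1" if "i < k" for i
      using step[of i] that by simp
    have "2 * m \<le> w 0 + w k" "w 0 + w k \<le> 2 * m + 1"
      unfolding m_def by presburger+
    then have m_between: "w 0 \<le> m \<and> m \<le> w k \<or> w k \<le> m \<and> m \<le> w 0"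
      by linarith
    obtain i where i: "i \<le> k" "w i = m"
    proof (cases "w 0 \<le> w k")
      case True
      then show ?thesis
        using that nat_intermed_int_val[of 0 k w m] step' m_between by auto
    next
      case False
      then have "\<exists>i. 0 \<le> i \<and> i \<le> k \<and> - w i = - m"
        using step' m_between by (intro nat_intermed_int_val) (auto simp: abs_minus_commute)
      then show ?thesis using that by auto
    qed
    have False
    proof (cases "even (w 0 + w k)")
      case True
      then have m: "w 0 + w k = 2 * m" by (simp add: m_def)
      \<comment> \<open>\<open>eq\<close> and \<open>reflect\<close> stop short of time
        \<open>k\<close>; if \<open>w k = m\<close>, then also \<open>w 0 = m\<close>.\<close>
      obtain i where i: "i < k" "w i = m"
      proof (cases "i = k")
        case True
        with i m have "w 0 = m" by simp
        with that[of 0] k show ?thesis by simp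
      next
        case False
        with i that[of i] show ?thesis by simp
      qed
      have "k \<noteq> 1"
      proof
        assume "k = 1"
        with m step[of 0] have "w 0 + w 1 = 2 * m" "\<bar>w 1 - w 0\<bar> = 1" by simp_all
        then show False by presburger
      qed
      then obtain i' where i': "i' < k" "i' = Suc i \<or> i = Suc i'"
        using i(1) that[of "Suc i"] that[of "i - 1"] by (cases "Suc i < k") auto
      \<comment> \<open>The reflection swaps \<open>m - 1\<close> and \<open>m + 1\<close>, so
        \<open>f\<close> would agree there.\<close>
      then have "w i' = m + 1 \<or> w i' = m - 1"
        using i step[of i] step[of i'] by (auto simp: abs_if split: if_splits)
      then show False
        using eq[OF i'(1)] reflect[OF i'(1)] m f2[of "m - 1"] by (auto simp: algebra_simps)
    next
      case False
      then have m: "w 0 + w k = 2 * m + 1" unfolding m_def by presburger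
      have "\<exists>j<k. w j = m \<or> w j = m + 1"
      proof (cases "i = k")
        case True
        with i m have "w 0 = m + 1" by simp
        with k show ?thesis by auto
      next
        case False
        with i show ?thesis by (intro exI[of _ i]) simp
      qed
      then obtain j where "j < k" "w j = m \<or> w j = m + 1" by blast
      then show False
        using eq[of j] reflect[of j] m f1[of m] by (auto simp: algebra_simps)
    qed
    then show ?thesis ..
  qed
qed

section \<open>The colouring of the grid\<close>

lemma vwalk_arcs_nth:
  "Suc i < length p \<Longrightarrow> (p ! i, p ! Suc i) \<in> set (vwalk_arcs p)"
proof (induction p arbitrary: i rule: vwalk_arcs.induct)
  case (3 x y xs)
  then show ?case by (cases i) auto
qed simp_all

text \<open>Encodes the pair of letters in base 4, hence 3 * 4 colours.\<close>

definition grid_coloring :: "int \<times> int \<Rightarrow> nat" where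
  "grid_coloring v = 4 * ternary_word (fst v) + quaternary_word (fst v + snd v)"

lemma grid_coloring_less: "grid_coloring v < 12"
  using ternary_word_less[of "fst v"] quaternary_word_less[of "fst v + snd v"]
  by (simp add: grid_coloring_def)

lemma grid_coloring_eqD:
  assumes "grid_coloring v = grid_coloring v'"
  shows "ternary_word (fst v) = ternary_word (fst v')"
    and "quaternary_word (fst v + snd v) = quaternary_word (fst v' + snd v')"
  using assms quaternary_word_less[of "fst v + snd v"] quaternary_word_less[of "fst v' + snd v'"]
  unfolding grid_coloring_def by presburger+

lemma nonrepetitive_grid_coloring:
  "nonrepetitive_coloring (infinite_path \<box> infinite_path) grid_coloring"
  unfolding nonrepetitive_coloring_def
proof (intro notI, elim exE conjE)
  fix k :: nat and v
  assume k: "k \<ge> 1" and path: "vpath v (with_proj (infinite_path \<box> infinite_path))"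
    and len: "length v = 2 * k"
    and rep: "\<forall>i<k. grid_coloring (v ! i) = grid_coloring (v ! (k + i))"
  define x where "x i = fst (v ! i)" for i
  define u where "u i = fst (v ! i) + snd (v ! i)" for i
  have u_step: "\<bar>u (Suc i) - u i\<bar> = 1"
    and x_step: "x (Suc i) = x i \<or> x (Suc i) - x i = u (Suc i) - u i" if "Suc i < 2 * k" for i
  proof -
    have "(v ! i, v ! Suc i) \<in> parcs (infinite_path \<box> infinite_path)"
      using vwalk_arcs_nth[of i v] that len path by (auto simp: vpath_def vwalk_def)
    then show "\<bar>u (Suc i) - u i\<bar> = 1" "x (Suc i) = x i \<or> x (Suc i) - x i = u (Suc i) - u i"
      by (auto simp: cartesian_product_def infinite_path_def x_def u_def)
  qed
  have u: "u (k + i) = u i" if "i < k" for i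
    using squarefree_quaternary_word quaternary_word_neq_Suc_Suc u_step
  proof (rule repetitive_walk_boring)
    show "i < k" by (rule that)
    show "quaternary_word (u i) = quaternary_word (u (k + i))" if "i < k" for i
      using grid_coloring_eqD(2)[of "v ! i" "v ! (k + i)"] rep that by (simp add: u_def)
  qed
  have x_rep: "ternary_word (x i) = ternary_word (x (k + i))" if "i < k" for i
    using grid_coloring_eqD(1)[of "v ! i" "v ! (k + i)"] rep that by (simp add: x_def)
  have proper: "ternary_word j \<noteq> ternary_word (j + 1)" for j
    by (rule squarefree_word_neq_Suc[OF squarefree_ternary_word])
  have x: "i < k \<Longrightarrow> x (k + i) = x i + (x k - x 0)" for i
  proof (induction i)
    case (Suc i)
    \<comment> \<open>A horizontal step is never matched with a vertical one, as \<open>ternary_word\<close> is proper.\<close>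
    define e where "e = u (Suc i) - u i"
    have e: "e = 1 \<or> e = - 1"
      using u_step[of i] Suc.prems by (auto simp: e_def)
    have "u (Suc (k + i)) - u (k + i) = e"
      using u[of i] u[of "Suc i"] Suc.prems by (simp add: e_def)
    then have "x (Suc i) = x i \<or> x (Suc i) = x i + e"
      "x (Suc (k + i)) = x (k + i) \<or> x (Suc (k + i)) = x (k + i) + e"
      using x_step[of i] x_step[of "k + i"] Suc.prems by (auto simp: e_def)
    then have "x (Suc (k + i)) - x (k + i) = x (Suc i) - x i"
      using e x_rep[of i] x_rep[of "Suc i"] Suc.prems proper[of "x i"] proper[of "x i - 1"]
        proper[of "x (k + i)"] proper[of "x (k + i) - 1"]
      by (elim disjE) simp_all
    with Suc show ?case by simp
  qed simp
  have "x k - x 0 = 0"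
  proof (rule squarefree_word_walk[OF squarefree_ternary_word, of k x])
    show "\<bar>x (Suc i) - x i\<bar> \<le> 1" if "i < k" for i
      using x_step[of i] u_step[of i] that by auto
    show "ternary_word (x i) = ternary_word (x i + (x k - x 0))" if "i < k" for i
      using x_rep[OF that] x[OF that] by simp
  qed simp
  with u[of 0] k have "v ! k = v ! 0"
    by (simp add: x_def u_def prod_eq_iff)
  with path len k show False
    by (auto simp: vpath_def nth_eq_iff_index_eq)
qed

theorem theorem2:
  shows "\<pi> (infinite_path \<box> infinite_path) \<le> 12"
proof -
  have "\<pi> (infinite_path \<box> infinite_path) \<le> enat 12"
    unfolding nonrepetitive_chromatic_number_le_iff
    using grid_coloring_less nonrepetitive_grid_coloring by blast
  then show ?thesis by (simp add: numeral_eq_enat)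
qed

end
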